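(* Given a numerical semigroup $S\neq\mathbb{N}$, the following conditions are equivalent: (1) $S$ is GAS; (2) $x-y\notin M-M$ for every two different elements $x,y\in M\setminus(S-K)$; (3) either $S$ is symmetric, or $2M\subseteq S-K\subseteq M$ and $M-M=((S-K)-M)\cup\{0\}$.
   Context: A numerical semigroup is a submonoid $S$ of $(\mathbb{N},+)$ (with $0\in\mathbb{N}$) such that $\mathbb{N}\setminus S$ is finite. $F(S)=\max(\mathbb{Z}\setminus S)$, $M=S\setminus\{0\}$, $K=\{x\in\mathbb{N}\mid F(S)-x\notin S\}$. $S$ has a unique minimal system of generators, whose elements are the minimal generators of $S$. For sets $X,Y\subseteq\mathbb{Z}$, $X-Y=\{z\in\mathbb{Z}\mid z+Y\subseteq X\}$ (so $M-M$, $S-K$, $(S-K)-M$ are meant in this sense), $X\setminus Y$ is the set difference, and $2X=X+X$. $PF(S)=(S-M)\setminus S$. $S$ is symmetric if $S=K$. $S$ is GAS if either $2K=K$ or $2K\setminus K=\{F(S)-x_1,\dots,F(S)-x_r,F(S)\}$ for some $r\ge 0$ and some minimal generators $x_1,\dots,x_r$ of $S$ such that $x_i-x_j\notin PF(S)$ for every $i,j$. *)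

theory Defs
  imports "HOL.Hull" "HOL-Library.Set_Algebras"
begin

text \<open>
  Numerical semigroups are represented as sets of integers contained in \<open>\<nat>\<close>, since the
  Frobenius number and the differences of sets live in the integers. On sets, \<open>X + Y\<close> is the
  Minkowski sum of \<open>HOL-Library.Set_Algebras\<close> (so \<open>X + X\<close> is what is usually written \<open>2X\<close>), and
  \<open>X - Y\<close> is the set-theoretic difference; the semigroup-theoretic difference is \<open>X \<ominus> Y\<close>.
\<close>

definition submonoid :: "int set \<Rightarrow> bool" where
  "submonoid T \<longleftrightarrow> 0 \<in> T \<and> (\<forall>x\<in>T. \<forall>y\<in>T. x + y \<in> T)"

definition numerical_semigroup :: "int set \<Rightarrow> bool" where
  "numerical_semigroup S \<longleftrightarrow> S \<subseteq> \<nat> \<and> submonoid S \<and> finite (\<nat> - S)"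

text \<open>\<open>- S\<close> is infinite (it contains all negative integers), so \<open>Max\<close> is not applicable.\<close>
definition frobenius :: "int set \<Rightarrow> int" where
  "frobenius S = (GREATEST z. z \<in> - S)"

definition max_ideal :: "int set \<Rightarrow> int set" where
  "max_ideal S = S - {0}"

definition canonical_ideal :: "int set \<Rightarrow> int set" where
  "canonical_ideal S = {x \<in> \<nat>. frobenius S - x \<notin> S}"

definition set_diff :: "int set \<Rightarrow> int set \<Rightarrow> int set"  (infixl \<open>\<ominus>\<close> 65) where
  "X \<ominus> Y = {z. \<forall>y\<in>Y. z + y \<in> X}"

definition pseudo_frobenius :: "int set \<Rightarrow> int set" where
  "pseudo_frobenius S = (S \<ominus> max_ideal S) - S"

definition symmetric_sg :: "int set \<Rightarrow> bool" where
  "symmetric_sg S \<longleftrightarrow> S = canonical_ideal S"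

definition minimal_generating_system :: "int set \<Rightarrow> int set \<Rightarrow> bool" where
  "minimal_generating_system S A \<longleftrightarrow>
     submonoid hull A = S \<and> (\<forall>B. B \<subset> A \<longrightarrow> submonoid hull B \<noteq> S)"

definition minimal_generators :: "int set \<Rightarrow> int set" where
  "minimal_generators S = (THE A. minimal_generating_system S A)"

definition GAS :: "int set \<Rightarrow> bool" where
  "GAS S \<longleftrightarrow>
     (let K = canonical_ideal S; F = frobenius S in
        K + K = K \<or>
        (\<exists>(r::nat) (x::nat \<Rightarrow> int).
           (K + K) - K = {F - x i | i. i \<in> {1..r}} \<union> {F} \<and>
           (\<forall>i\<in>{1..r}. x i \<in> minimal_generators S) \<and>
           (\<forall>i\<in>{1..r}. \<forall>j\<in>{1..r}. x i - x j \<notin> pseudo_frobenius S)))"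

text \<open>The definite descriptions above are well defined.\<close>

lemma frobenius_greatest:
  assumes "numerical_semigroup S"
  shows "frobenius S \<notin> S" and "\<And>z. z \<notin> S \<Longrightarrow> z \<le> frobenius S"
proof -
  have fin: "finite (\<nat> - S)" and sub: "S \<subseteq> \<nat>"
    using assms by (auto simp: numerical_semigroup_def)
  let ?A = "insert (-1) (\<nat> - S)"
  have nonneg: "z \<in> \<nat> \<longleftrightarrow> z \<ge> 0" for z :: int
    by (metis Nats_cases int_nat_eq of_nat_0_le_iff of_nat_in_Nats)
  have Max_notin: "Max ?A \<notin> S"
    using Max_in[of ?A] fin sub nonneg[of "-1"] by auto
  have upper: "z \<le> Max ?A" if "z \<notin> S" for z
  proof (cases "z \<ge> 0")
    case True
    then show ?thesis using that fin by (intro Max_ge) (auto simp: nonneg)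
  next
    case False
    then have "z \<le> -1" by simp
    also have "\<dots> \<le> Max ?A" using fin by (intro Max_ge) auto
    finally show ?thesis .
  qed
  have "frobenius S = Max ?A"
    unfolding frobenius_def using Max_notin upper by (intro Greatest_equality) auto
  then show "frobenius S \<notin> S" and "\<And>z. z \<notin> S \<Longrightarrow> z \<le> frobenius S"
    using Max_notin upper by auto
qed

lemma minimal_generating_system_unique:
  assumes "numerical_semigroup S"
  shows "\<exists>!A. minimal_generating_system S A"
proof -
  have S0: "0 \<in> S" and closed: "\<And>x y. x \<in> S \<Longrightarrow> y \<in> S \<Longrightarrow> x + y \<in> S"
    and pos: "\<And>x. x \<in> S \<Longrightarrow> x \<ge> 0"
    using assms by (auto simp: numerical_semigroup_def submonoid_def Nats_def)
  have subS: "submonoid S" using assms by (simp add: numerical_semigroup_def)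
  define M where "M = S - {0}"
  define I where "I = M - (M + M)"
  have hull_sub: "submonoid (submonoid hull A)" for A
    by (rule hull_in) (auto simp: submonoid_def)
  have Mpos: "x > 0" if "x \<in> M" for x using pos[of x] that by (auto simp: M_def)
  have gen_I: "submonoid hull I = S"
  proof
    show "submonoid hull I \<subseteq> S"
      by (rule hull_minimal) (auto simp: I_def M_def subS)
    have "x \<in> S \<Longrightarrow> x \<in> submonoid hull I" for x
    proof (induction "nat x" arbitrary: x rule: less_induct)
      case less
      consider "x = 0" | "x \<in> I" | "x \<in> M + M"
        using less.prems by (auto simp: I_def M_def)
      then show ?case
      proof cases
        case 1
        then show ?thesis using hull_sub[of I] by (simp add: submonoid_def)
      next
        case 2
        then show ?thesis by (rule hull_inc)
      next
        case 3
        then obtain a b where ab: "x = a + b" "a \<in> M" "b \<in> M" by (elim set_plus_elim)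
        then have "a \<in> submonoid hull I" "b \<in> submonoid hull I"
          using Mpos[of a] Mpos[of b] by (auto intro!: less.hyps simp: M_def)
        then show ?thesis using hull_sub[of I] ab by (simp add: submonoid_def)
      qed
    qed
    then show "S \<subseteq> submonoid hull I" by blast
  qed
  have I_least: "I \<subseteq> A" if A: "submonoid hull A = S" for A
  proof
    fix x assume x: "x \<in> I"
    show "x \<in> A"
    proof (rule ccontr)
      assume "x \<notin> A"
      have "a + b \<noteq> x" if "a \<in> S" "b \<in> S" "a \<noteq> x" "b \<noteq> x" for a b
        using x that set_plus_intro[of a M b M] by (auto simp: I_def M_def)
      moreover have "0 \<noteq> x" using x by (auto simp: I_def M_def)
      ultimately have "submonoid (S - {x})"
        using S0 closed by (auto simp: submonoid_def)
      moreover have "A \<subseteq> S - {x}" using hull_subset[of A submonoid] A \<open>x \<notin> A\<close> by auto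
      ultimately have "submonoid hull A \<subseteq> S - {x}" by (rule hull_minimal[rotated])
      then show False using A x by (auto simp: I_def M_def)
    qed
  qed
  show ?thesis
  proof (rule ex1I[of _ I])
    show "minimal_generating_system S I"
      using gen_I I_least by (auto simp: minimal_generating_system_def)
  next
    fix A assume "minimal_generating_system S A"
    then show "A = I"
      using gen_I I_least[of A] by (auto simp: minimal_generating_system_def)
  qed
qed

end

theory Submission
  imports Defs
begin

text \<open>
  Write \<open>F\<close> for the Frobenius number and \<open>D\<close> for the set \<open>M - (S \<ominus> K)\<close> of condition (2).

  The bridge between GAS and \<open>D\<close> is the duality of \<open>K\<close>: an integer \<open>z\<close> lies in \<open>S\<close> iff
  \<open>F - z\<close> does not lie in \<open>K\<close>, whence \<open>z\<close> lies in \<open>S \<ominus> K\<close> iff \<open>F - z\<close> does not lie in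
  \<open>K + K\<close>. So \<open>x \<mapsto> F - x\<close> maps \<open>D\<close> onto the part of \<open>(K + K) - K\<close> different from \<open>F\<close>, and
  \<open>F\<close> itself is in \<open>(K + K) - K\<close> as soon as this set is nonempty. Hence GAS says that
  \<open>K + K = K\<close>, or that \<open>D\<close> consists of minimal generators no two of which differ by a
  pseudo-Frobenius number.

  Now \<open>M \<ominus> M\<close> is the union of \<open>S\<close> and the pseudo-Frobenius numbers. Two distinct minimal
  generators never differ by an element of \<open>S\<close>, so GAS implies (2). Conversely, if an element
  \<open>a + b\<close> of \<open>D\<close> is decomposable in \<open>M\<close>, then \<open>a\<close> is in \<open>D\<close> too because \<open>S \<ominus> K\<close> is an ideal,
  and the difference \<open>b\<close> violates (2); so (2) forces \<open>D\<close> to consist of minimal generators.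

  If \<open>S\<close> is symmetric, then \<open>D\<close> is empty and (2) holds trivially. In the other alternative of
  (3), the inclusion \<open>M + M \<subseteq> S \<ominus> K\<close> says that \<open>D\<close> consists of minimal generators, and
  \<open>S \<ominus> K \<subseteq> M\<close> holds whenever \<open>S\<close> is not symmetric. The equation for \<open>M \<ominus> M\<close> says that a
  nonzero \<open>z\<close> in \<open>M \<ominus> M\<close> moves all of \<open>M\<close> into \<open>S \<ominus> K\<close>. As \<open>M \<ominus> M\<close> always maps the nonzero
  elements of \<open>S \<ominus> K\<close> into \<open>S \<ominus> K\<close>, this can fail only if \<open>z\<close> moves an element of \<open>D\<close> to another
  element of \<open>D\<close>, which is what (2) excludes.
\<close>

lemma Nats_int_iff: "x \<in> \<nat> \<longleftrightarrow> 0 \<le> x" for x :: int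
  by (auto simp: Nats_altdef1)

lemma in_set_diff: "z \<in> X \<ominus> Y \<longleftrightarrow> (\<forall>y\<in>Y. z + y \<in> X)"
  by (simp add: set_diff_def)

context
  fixes S :: "int set"
  assumes S: "numerical_semigroup S"
begin

lemma zero_mem: "0 \<in> S"
  and add_mem: "x \<in> S \<Longrightarrow> y \<in> S \<Longrightarrow> x + y \<in> S"
  and nonneg_mem: "x \<in> S \<Longrightarrow> 0 \<le> x"
  using S by (auto simp: numerical_semigroup_def submonoid_def Nats_def)

lemma pos_max_ideal: "x \<in> max_ideal S \<Longrightarrow> 0 < x"
  using nonneg_mem[of x] by (auto simp: max_ideal_def)

lemma max_ideal_add: "x \<in> max_ideal S \<Longrightarrow> y \<in> S \<Longrightarrow> x + y \<in> max_ideal S"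
  using add_mem[of x y] pos_max_ideal[of x] nonneg_mem[of y] by (auto simp: max_ideal_def)

lemma mem_above_frobenius: "frobenius S < z \<Longrightarrow> z \<in> S"
  using frobenius_greatest(2)[OF S, of z] by linarith

section \<open>Minimal generators\<close>

lemma indecomposables_generate:
  "submonoid hull (max_ideal S - (max_ideal S + max_ideal S)) = S" (is "submonoid hull ?I = S")
proof
  have hull: "submonoid (submonoid hull ?I)"
    by (rule hull_in) (auto simp: submonoid_def)
  show "submonoid hull ?I \<subseteq> S"
    using S by (intro hull_minimal) (auto simp: max_ideal_def numerical_semigroup_def)
  have "x \<in> S \<Longrightarrow> x \<in> submonoid hull ?I" for x
  proof (induction "nat x" arbitrary: x rule: less_induct)
    case less
    consider "x = 0" | "x \<in> ?I" | "x \<in> max_ideal S + max_ideal S"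
      using less.prems by (auto simp: max_ideal_def)
    then show ?case
    proof cases
      case 1
      then show ?thesis using hull by (simp add: submonoid_def)
    next
      case 2
      then show ?thesis by (rule hull_inc)
    next
      case 3
      then obtain a b where ab: "x = a + b" "a \<in> max_ideal S" "b \<in> max_ideal S"
        by (elim set_plus_elim)
      then have "a \<in> submonoid hull ?I" "b \<in> submonoid hull ?I"
        using pos_max_ideal[of a] pos_max_ideal[of b] less.hyps[of a] less.hyps[of b]
        unfolding max_ideal_def by simp_all
      then show ?thesis using hull ab(1) by (simp add: submonoid_def)
    qed
  qed
  then show "S \<subseteq> submonoid hull ?I" by blast
qed

text \<open>Removing an indecomposable element from \<open>S\<close> leaves a submonoid, so a set that omits it
  cannot generate \<open>S\<close>.\<close>

lemma indecomposables_least: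
  assumes A: "submonoid hull A = S"
  shows "max_ideal S - (max_ideal S + max_ideal S) \<subseteq> A"
proof
  fix x assume x: "x \<in> max_ideal S - (max_ideal S + max_ideal S)"
  show "x \<in> A"
  proof (rule ccontr)
    assume "x \<notin> A"
    have "a + b \<noteq> x" if "a \<in> S" "b \<in> S" "a \<noteq> x" "b \<noteq> x" for a b
      using x that set_plus_intro[of a "max_ideal S" b "max_ideal S"]
      by (auto simp: max_ideal_def)
    moreover have "0 \<noteq> x" using x by (auto simp: max_ideal_def)
    ultimately have "submonoid (S - {x})"
      using zero_mem add_mem by (auto simp: submonoid_def)
    moreover have "A \<subseteq> S - {x}" using hull_subset[of A submonoid] A \<open>x \<notin> A\<close> by auto
    ultimately have "submonoid hull A \<subseteq> S - {x}" by (rule hull_minimal[rotated])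
    then show False using A x by (auto simp: max_ideal_def)
  qed
qed

lemma minimal_generators_eq:
  "minimal_generators S = max_ideal S - (max_ideal S + max_ideal S)"
proof -
  have "minimal_generating_system S (max_ideal S - (max_ideal S + max_ideal S))"
    unfolding minimal_generating_system_def
    using indecomposables_generate indecomposables_least by blast
  then show ?thesis
    unfolding minimal_generators_def
    by (rule the1_equality[OF minimal_generating_system_unique[OF S]])
qed

section \<open>Duality for the canonical ideal\<close>

text \<open>The restriction to \<open>\<nat>\<close> in the definition of \<open>K\<close> is automatic, since \<open>F - x\<close> exceeds
  \<open>F\<close>, and so lies in \<open>S\<close>, for negative \<open>x\<close>. This makes the duality valid for all integers.\<close>

lemma canonical_ideal_iff: "x \<in> canonical_ideal S \<longleftrightarrow> frobenius S - x \<notin> S"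
  using mem_above_frobenius[of "frobenius S - x"]
  by (cases "x < 0") (auto simp: canonical_ideal_def Nats_int_iff)

lemma mem_dual: "z \<in> S \<longleftrightarrow> frobenius S - z \<notin> canonical_ideal S"
  by (simp add: canonical_ideal_iff)

lemma zero_mem_canonical_ideal: "0 \<in> canonical_ideal S"
  using frobenius_greatest(1)[OF S] by (simp add: canonical_ideal_iff)

lemma canonical_ideal_add: "k \<in> canonical_ideal S \<Longrightarrow> s \<in> S \<Longrightarrow> k + s \<in> canonical_ideal S"
  using add_mem[of "frobenius S - (k + s)" s] by (auto simp: canonical_ideal_iff)

lemma subset_canonical_ideal: "S \<subseteq> canonical_ideal S"
  using canonical_ideal_add[OF zero_mem_canonical_ideal] by auto

lemma canonical_double_nonneg: "w \<in> canonical_ideal S + canonical_ideal S \<Longrightarrow> 0 \<le> w"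
  by (auto simp: canonical_ideal_def Nats_int_iff elim!: set_plus_elim)

lemma dual_canonical_double:
  "z \<in> S \<ominus> canonical_ideal S \<longleftrightarrow> frobenius S - z \<notin> canonical_ideal S + canonical_ideal S"
proof -
  have "z \<in> S \<ominus> canonical_ideal S
      \<longleftrightarrow> (\<forall>k\<in>canonical_ideal S. frobenius S - z - k \<notin> canonical_ideal S)"
    by (simp add: in_set_diff mem_dual diff_diff_eq)
  also have "\<dots> \<longleftrightarrow> frobenius S - z \<notin> canonical_ideal S + canonical_ideal S"
    by (force simp: set_plus_def)
  finally show ?thesis .
qed

lemma set_diff_canonical_subset: "S \<ominus> canonical_ideal S \<subseteq> S"
  using zero_mem_canonical_ideal by (force simp: in_set_diff)

lemma set_diff_canonical_add:
  "z \<in> S \<ominus> canonical_ideal S \<Longrightarrow> s \<in> S \<Longrightarrow> z + s \<in> S \<ominus> canonical_ideal S"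
  using canonical_ideal_add by (force simp: in_set_diff add.assoc add.commute[of s])

text \<open>Dually to \<open>S \<ominus> K\<close> being an ideal, \<open>K + K\<close> is stable under adding elements of \<open>S\<close>. An
  element \<open>w\<close> outside \<open>K\<close> has \<open>F - w\<close> in \<open>S\<close>, and adding this to \<open>w\<close> gives \<open>F\<close>.\<close>

lemma frobenius_in_canonical_double:
  assumes "canonical_ideal S + canonical_ideal S \<noteq> canonical_ideal S"
  shows "frobenius S \<in> canonical_ideal S + canonical_ideal S"
proof -
  have "canonical_ideal S \<subseteq> canonical_ideal S + canonical_ideal S"
    using zero_mem_canonical_ideal by (rule set_zero_plus2)
  with assms obtain w where "w \<in> canonical_ideal S + canonical_ideal S" "w \<notin> canonical_ideal S"
    by blast
  then have "frobenius S - w \<in> S" "frobenius S - w \<notin> S \<ominus> canonical_ideal S"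
    by (auto simp: canonical_ideal_iff dual_canonical_double)
  then have "0 \<notin> S \<ominus> canonical_ideal S"
    using set_diff_canonical_add[of 0 "frobenius S - w"] by auto
  then show ?thesis by (simp add: dual_canonical_double)
qed

lemma obstruction_iff:
  "x \<in> max_ideal S - (S \<ominus> canonical_ideal S) \<longleftrightarrow>
     x \<noteq> 0 \<and> frobenius S - x \<in> (canonical_ideal S + canonical_ideal S) - canonical_ideal S"
  by (auto simp: max_ideal_def dual_canonical_double mem_dual[of x])

lemma finite_obstruction: "finite (max_ideal S - (S \<ominus> canonical_ideal S))"
proof (rule finite_subset)
  show "max_ideal S - (S \<ominus> canonical_ideal S) \<subseteq> {0..frobenius S}"
    using canonical_double_nonneg pos_max_ideal by (force simp: dual_canonical_double)
qed simp

lemma symmetric_imp_obstruction_empty: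
  assumes "symmetric_sg S"
  shows "max_ideal S - (S \<ominus> canonical_ideal S) = {}"
  using assms add_mem by (auto simp: symmetric_sg_def in_set_diff max_ideal_def)

section \<open>The endomorphisms of the maximal ideal\<close>

lemma set_diff_max_ideal_eq:
  assumes "S \<noteq> \<nat>"
  shows "max_ideal S \<ominus> max_ideal S = S \<union> pseudo_frobenius S"
proof -
  have "0 < frobenius S"
  proof -
    obtain n where "n \<in> \<nat>" "n \<notin> S"
      using assms S by (auto simp: numerical_semigroup_def)
    then show ?thesis
      using frobenius_greatest(2)[OF S, of n] zero_mem by (cases "n = 0") (auto simp: Nats_int_iff)
  qed
  \<comment> \<open>A shift of \<open>M\<close> that hits \<open>0\<close> is by some \<open>- m\<close> with \<open>m\<close> in \<open>M\<close>. It sends \<open>F + m\<close>, which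
     is in \<open>M\<close> as \<open>F > 0\<close>, to \<open>F\<close>, so it does not keep \<open>M\<close> inside \<open>S\<close>.\<close>
  then have "z + m \<noteq> 0" if "z \<in> S \<ominus> max_ideal S" "m \<in> max_ideal S" for z m
  proof -
    have "frobenius S + m \<in> max_ideal S"
      using \<open>0 < frobenius S\<close> pos_max_ideal[OF that(2)] mem_above_frobenius
      by (auto simp: max_ideal_def)
    then have "z + (frobenius S + m) \<in> S" using that(1) by (auto simp: in_set_diff)
    moreover have "z + (frobenius S + m) = frobenius S + (z + m)" by simp
    ultimately show ?thesis using frobenius_greatest(1)[OF S] by auto
  qed
  then have "max_ideal S \<ominus> max_ideal S = S \<ominus> max_ideal S"
    by (auto simp: in_set_diff max_ideal_def)
  also have "\<dots> = S \<union> pseudo_frobenius S"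
    using add_mem by (auto simp: pseudo_frobenius_def in_set_diff max_ideal_def)
  finally show ?thesis .
qed

text \<open>If \<open>m + k\<close> is in \<open>S\<close> for all \<open>k\<close> in \<open>K\<close>, then these sums are in \<open>M\<close>, being at least
  \<open>m > 0\<close>; so they stay in \<open>M\<close> after adding \<open>z\<close>.\<close>

lemma set_diff_max_ideal_acts:
  assumes z: "z \<in> max_ideal S \<ominus> max_ideal S"
    and m: "m \<in> max_ideal S" "m \<in> S \<ominus> canonical_ideal S"
  shows "z + m \<in> S \<ominus> canonical_ideal S"
  unfolding in_set_diff
proof
  fix k assume k: "k \<in> canonical_ideal S"
  then have "0 \<le> k" by (simp add: canonical_ideal_def Nats_int_iff)
  with k m have "m + k \<in> max_ideal S"
    using pos_max_ideal[OF m(1)] by (auto simp: in_set_diff max_ideal_def)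
  with z have "z + (m + k) \<in> max_ideal S" by (simp add: in_set_diff)
  then show "z + m + k \<in> S" by (simp add: max_ideal_def add.assoc)
qed

section \<open>The three conditions\<close>

lemma GAS_iff_obstruction:
  "GAS S \<longleftrightarrow> canonical_ideal S + canonical_ideal S = canonical_ideal S \<or>
     (max_ideal S - (S \<ominus> canonical_ideal S) \<subseteq> minimal_generators S \<and>
      (\<forall>x \<in> max_ideal S - (S \<ominus> canonical_ideal S). \<forall>y \<in> max_ideal S - (S \<ominus> canonical_ideal S).
         x - y \<notin> pseudo_frobenius S))"
  (is "_ \<longleftrightarrow> ?K + ?K = ?K \<or> (?D \<subseteq> _ \<and> _)")
proof (cases "?K + ?K = ?K")
  case True
  then show ?thesis by (simp add: GAS_def)
next
  case False
  let ?F = "frobenius S"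
  have F: "?F \<in> (?K + ?K) - ?K"
    using frobenius_in_canonical_double[OF False] zero_mem by (simp add: mem_dual)
  have double: "(?K + ?K) - ?K = {?F - x | x. x \<in> ?D} \<union> {?F}"
  proof -
    have "w \<in> (?K + ?K) - ?K \<longleftrightarrow> w = ?F \<or> ?F - w \<in> ?D" for w
      unfolding obstruction_iff using F by auto
    moreover have "w \<in> {?F - x | x. x \<in> ?D} \<longleftrightarrow> ?F - w \<in> ?D" for w
      by (smt (verit, ccfv_threshold) mem_Collect_eq)
    ultimately show ?thesis by blast
  qed
  show ?thesis
  proof
    assume "GAS S"
    with False obtain r :: nat and x :: "nat \<Rightarrow> int" where
      eq: "(?K + ?K) - ?K = {?F - x i | i. i \<in> {1..r}} \<union> {?F}"
      and gen: "\<forall>i\<in>{1..r}. x i \<in> minimal_generators S"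
      and pf: "\<forall>i\<in>{1..r}. \<forall>j\<in>{1..r}. x i - x j \<notin> pseudo_frobenius S"
      by (auto simp: GAS_def Let_def)
    have "?D \<subseteq> x ` {1..r}"
      unfolding subset_iff obstruction_iff eq by auto
    then show "?K + ?K = ?K \<or> (?D \<subseteq> minimal_generators S \<and>
        (\<forall>x\<in>?D. \<forall>y\<in>?D. x - y \<notin> pseudo_frobenius S))"
      using gen pf by blast
  next
    assume "?K + ?K = ?K \<or> (?D \<subseteq> minimal_generators S \<and>
        (\<forall>x\<in>?D. \<forall>y\<in>?D. x - y \<notin> pseudo_frobenius S))"
    with False have D: "?D \<subseteq> minimal_generators S"
        "\<forall>x\<in>?D. \<forall>y\<in>?D. x - y \<notin> pseudo_frobenius S"
      by auto
    obtain r :: nat and h where h: "?D = h ` {1..r}"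
      using ex_bij_betw_nat_finite_1[OF finite_obstruction] unfolding bij_betw_def by blast
    have "(?K + ?K) - ?K = {?F - h i | i. i \<in> {1..r}} \<union> {?F}"
      unfolding double h by blast
    moreover have "h i \<in> ?D" if "i \<in> {1..r}" for i
      unfolding h using that by (rule imageI)
    ultimately show "GAS S"
      unfolding GAS_def Let_def using D by (intro disjI2 exI[of _ r] exI[of _ h]) blast
  qed
qed

lemma GAS_iff_differences:
  assumes "S \<noteq> \<nat>"
  shows "GAS S \<longleftrightarrow>
    (\<forall>x \<in> max_ideal S - (S \<ominus> canonical_ideal S). \<forall>y \<in> max_ideal S - (S \<ominus> canonical_ideal S).
       x \<noteq> y \<longrightarrow> x - y \<notin> max_ideal S \<ominus> max_ideal S)"
  (is "_ \<longleftrightarrow> (\<forall>x\<in>?D. \<forall>y\<in>?D. _ x y)")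
proof
  assume "GAS S"
  then consider "?D = {}"
    | "?D \<subseteq> minimal_generators S" "\<forall>x\<in>?D. \<forall>y\<in>?D. x - y \<notin> pseudo_frobenius S"
    unfolding GAS_iff_obstruction using obstruction_iff by blast
  then show "\<forall>x\<in>?D. \<forall>y\<in>?D. x \<noteq> y \<longrightarrow> x - y \<notin> max_ideal S \<ominus> max_ideal S"
  proof cases
    case 1
    then show ?thesis by blast
  next
    case 2
    have "x - y \<notin> S" if "x \<in> ?D" "y \<in> ?D" "x \<noteq> y" for x y
    proof
      assume "x - y \<in> S"
      then have "y + (x - y) \<in> max_ideal S + max_ideal S"
        using that by (intro set_plus_intro) (auto simp: max_ideal_def)
      then show False using 2(1) that(1) by (auto simp: minimal_generators_eq)
    qed
    then show ?thesis using 2(2) by (auto simp: set_diff_max_ideal_eq[OF assms])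
  qed
next
  assume diffs: "\<forall>x\<in>?D. \<forall>y\<in>?D. x \<noteq> y \<longrightarrow> x - y \<notin> max_ideal S \<ominus> max_ideal S"
  have "x \<notin> max_ideal S + max_ideal S" if x: "x \<in> ?D" for x
  proof
    assume "x \<in> max_ideal S + max_ideal S"
    then obtain a b where ab: "x = a + b" "a \<in> max_ideal S" "b \<in> max_ideal S"
      by (elim set_plus_elim)
    then have "a \<in> ?D" "x - a \<in> S" "x \<noteq> a"
      using x set_diff_canonical_add[of a b] by (auto simp: max_ideal_def)
    then show False using diffs x by (auto simp: set_diff_max_ideal_eq[OF assms])
  qed
  moreover have "x - y \<notin> pseudo_frobenius S" if "x \<in> ?D" "y \<in> ?D" for x y
    using diffs that zero_mem set_diff_max_ideal_eq[OF assms]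
    by (cases "x = y") (auto simp: pseudo_frobenius_def)
  ultimately show "GAS S"
    unfolding GAS_iff_obstruction minimal_generators_eq by blast
qed

lemma differences_iff_endomorphisms:
  assumes "S \<noteq> \<nat>"
  shows "(\<forall>x \<in> max_ideal S - (S \<ominus> canonical_ideal S). \<forall>y \<in> max_ideal S - (S \<ominus> canonical_ideal S).
       x \<noteq> y \<longrightarrow> x - y \<notin> max_ideal S \<ominus> max_ideal S) \<longleftrightarrow>
    symmetric_sg S \<or>
      (max_ideal S + max_ideal S \<subseteq> S \<ominus> canonical_ideal S \<and>
       S \<ominus> canonical_ideal S \<subseteq> max_ideal S \<and>
       max_ideal S \<ominus> max_ideal S = ((S \<ominus> canonical_ideal S) \<ominus> max_ideal S) \<union> {0})"
  (is "?L \<longleftrightarrow> symmetric_sg S \<or> (?M + ?M \<subseteq> ?C \<and> ?C \<subseteq> ?M \<and> ?E)")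
proof (cases "symmetric_sg S")
  case True
  then show ?thesis using symmetric_imp_obstruction_empty by blast
next
  case False
  have "0 \<notin> ?C"
    using False subset_canonical_ideal by (auto simp: in_set_diff symmetric_sg_def)
  then have C_sub: "?C \<subseteq> ?M"
    using set_diff_canonical_subset by (auto simp: max_ideal_def)
  have "?M + ?M \<subseteq> ?C \<and> ?E" if ?L
  proof (intro conjI)
    show "?M + ?M \<subseteq> ?C"
    proof
      fix x assume "x \<in> ?M + ?M"
      then obtain a b where ab: "x = a + b" "a \<in> ?M" "b \<in> ?M" by (elim set_plus_elim)
      show "x \<in> ?C"
      proof (rule ccontr)
        assume "x \<notin> ?C"
        then have "x \<in> ?M - ?C" "a \<in> ?M - ?C" "x \<noteq> a" "x - a \<in> S"
          using ab max_ideal_add[of a b] set_diff_canonical_add[of a b]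
          by (auto simp: max_ideal_def)
        then show False using \<open>?L\<close> by (auto simp: set_diff_max_ideal_eq[OF assms])
      qed
    qed
    have "z + m \<in> ?C" if z: "z \<in> ?M \<ominus> ?M" "z \<noteq> 0" and m: "m \<in> ?M" for z m
    proof (rule ccontr)
      assume nC: "z + m \<notin> ?C"
      then have "m \<in> ?M - ?C" using set_diff_max_ideal_acts[OF z(1) m] m by auto
      moreover have "z + m \<in> ?M - ?C" using nC z(1) m by (auto simp: in_set_diff)
      moreover have "z + m \<noteq> m" "(z + m) - m \<in> ?M \<ominus> ?M" using z by auto
      ultimately show False using \<open>?L\<close> by blast
    qed
    then have "?M \<ominus> ?M \<subseteq> (?C \<ominus> ?M) \<union> {0}"
      unfolding in_set_diff[of _ ?C] subset_iff Un_iff by blast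
    moreover have "(?C \<ominus> ?M) \<union> {0} \<subseteq> ?M \<ominus> ?M"
      using C_sub unfolding in_set_diff[of _ ?C] in_set_diff[of _ ?M] subset_iff Un_iff by auto
    ultimately show ?E by (rule equalityI)
  qed
  moreover have ?L if ?E
  proof (intro ballI impI notI)
    fix x y assume "x \<in> ?M - ?C" "y \<in> ?M - ?C" "x \<noteq> y" "x - y \<in> ?M \<ominus> ?M"
    moreover from this have "x - y \<in> ?C \<ominus> ?M" using \<open>?E\<close> by auto
    ultimately show False by (auto simp: in_set_diff[of _ ?C])
  qed
  ultimately show ?thesis using False C_sub by blast
qed

end

theorem proposition3p5:
  fixes S K M :: "int set"
  assumes "numerical_semigroup S" and "S \<noteq> \<nat>"
  defines "K \<equiv> canonical_ideal S" and "M \<equiv> max_ideal S"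
  shows "(GAS S \<longleftrightarrow>
            (\<forall>x \<in> M - (S \<ominus> K). \<forall>y \<in> M - (S \<ominus> K). x \<noteq> y \<longrightarrow> x - y \<notin> M \<ominus> M))
       \<and> (GAS S \<longleftrightarrow>
            symmetric_sg S \<or>
            (M + M \<subseteq> S \<ominus> K \<and> S \<ominus> K \<subseteq> M \<and> M \<ominus> M = ((S \<ominus> K) \<ominus> M) \<union> {0}))"
  unfolding K_def M_def
  using GAS_iff_differences[OF assms(1,2)] differences_iff_endomorphisms[OF assms(1,2)] by blast

end
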